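(* Let $K>1$, $\theta\in(-\pi/2,\pi/2]$ and $c\in\mathbb{C}$, and let $H_{K,\theta,c}(z)=\left[\left(\frac{K+1}{2}\right)z+e^{2i\theta}\left(\frac{K-1}{2}\right)\overline{z}\right]^2+c$. There exists a non-negative, continuous function $G_{K,\theta,c}:\mathbb{C}\to\mathbb{R}$ that is identically zero on $BO(H_{K,\theta,c})$, non-zero (at every point) on $I(H_{K,\theta,c})$, and such that \[ G_{K,\theta,c}(H_{K,\theta,c}(z))=2G_{K,\theta,c}(z) \] for all $z\in\mathbb{C}$.
   Context: For a map $f:\mathbb{C}\to\mathbb{C}$, $f^n$ denotes the $n$-th iterate. The escaping set is $I(f)=\{z\in\mathbb{C}: f^n(z)\to\infty\}$ and the bounded orbit set is $BO(f)=\{z\in\mathbb{C}: \exists M>0 \text{ with } |f^n(z)|\le M \text{ for all } n\in\mathbb{N}\}$. *)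

theory Defs
  imports "HOL-Analysis.Analysis"
begin

definition escaping_set :: "(complex \<Rightarrow> complex) \<Rightarrow> complex set" where
  "escaping_set f = {z. filterlim (\<lambda>n. (f ^^ n) z) at_infinity sequentially}"

definition bounded_orbit_set :: "(complex \<Rightarrow> complex) \<Rightarrow> complex set" where
  "bounded_orbit_set f = {z. \<exists>M>0. \<forall>n. cmod ((f ^^ n) z) \<le> M}"

definition H_map :: "real \<Rightarrow> real \<Rightarrow> complex \<Rightarrow> complex \<Rightarrow> complex" where
  "H_map K \<theta> c z =
     (complex_of_real ((K + 1) / 2) * z
        + exp (2 * \<i> * complex_of_real \<theta>) * complex_of_real ((K - 1) / 2) * cnj z)\<^sup>2 + c"

end

theory Submission
  imports Defs
begin

text \<open>
  Up to a bounded error, \<open>u z = ln (1 + \<bar>z\<bar>)\<close> is doubled by \<open>H\<close>: the linear map that is squared in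
  \<open>H\<close> satisfies \<open>\<bar>z\<bar> \<le> \<bar>L z\<bar> \<le> K \<bar>z\<bar>\<close>. Hence \<open>u (H\<^sup>n z) / 2\<^sup>n\<close> converges uniformly on the whole plane,
  and its limit \<open>G\<close> stays within bounded distance of \<open>u\<close>. On an escaping orbit \<open>u\<close> exceeds
  this distance eventually, so \<open>G\<close> is positive there.
\<close>

text \<open>Consecutive terms of the sequence differ by at most \<open>C / 2 ^ Suc n\<close>,
  whatever the point. These bounds sum to exactly \<open>C\<close>, so the telescoping series
  converges uniformly by the Weierstrass test, and the same sum bounds the distance from
  \<open>G\<close> to the initial term \<open>u\<close>.\<close>

lemma uniform_limit_doubling_average:
  fixes u :: "'a \<Rightarrow> real"
  assumes "\<And>x. \<bar>u (f x) - 2 * u x\<bar> \<le> C"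
  obtains G where "uniform_limit UNIV (\<lambda>n x. u ((f ^^ n) x) / 2 ^ n) G sequentially"
    and "\<And>x. \<bar>G x - u x\<bar> \<le> C"
proof -
  define d where "d n x = u ((f ^^ Suc n) x) / 2 ^ Suc n - u ((f ^^ n) x) / 2 ^ n" for n x
  define M where "M n = C / 2 * (1 / 2) ^ n" for n
  have d_le: "norm (d n x) \<le> M n" for n x
  proof -
    have "d n x = (u (f ((f ^^ n) x)) - 2 * u ((f ^^ n) x)) / 2 ^ Suc n"
      by (simp add: d_def field_simps)
    moreover have "\<bar>u (f ((f ^^ n) x)) - 2 * u ((f ^^ n) x)\<bar> / 2 ^ Suc n \<le> C / 2 ^ Suc n"
      by (intro divide_right_mono assms) simp
    ultimately show ?thesis
      by (simp add: M_def power_divide abs_divide)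
  qed
  have M_sums: "M sums C"
    using sums_mult[OF geometric_sums[of "1 / 2 :: real"], of "C / 2"] by (simp add: M_def[abs_def])
  define G where "G x = u x + (\<Sum>n. d n x)" for x
  have telescope: "u x + (\<Sum>i<n. d i x) = u ((f ^^ n) x) / 2 ^ n" for n x
    unfolding d_def by (subst sum_lessThan_telescope) simp
  have "uniform_limit UNIV (\<lambda>n x. \<Sum>i<n. d i x) (\<lambda>x. \<Sum>i. d i x) sequentially"
    using M_sums by (intro Weierstrass_m_test[where M = M] d_le) (auto simp: sums_iff)
  then have "uniform_limit UNIV (\<lambda>n x. u x + (\<Sum>i<n. d i x)) G sequentially"
    unfolding G_def[abs_def] by (intro uniform_limit_intros)
  then have lim: "uniform_limit UNIV (\<lambda>n x. u ((f ^^ n) x) / 2 ^ n) G sequentially"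
    by (simp add: telescope)
  have "\<bar>G x - u x\<bar> \<le> C" for x
    using norm_suminf_le[of "\<lambda>n. d n x" M] d_le M_sums by (simp add: G_def sums_iff)
  with lim show thesis
    using that by blast
qed

text \<open>The exponential is unimodular because \<open>\<theta>\<close> is real, so the two
  summands have norms \<open>(K + 1) / 2\<close> and \<open>(K - 1) / 2\<close> times
  \<open>cmod z\<close>. The difference of these factors is \<open>1\<close> and their sum is
  \<open>K\<close>; the triangle inequality does the rest.\<close>

lemma H_map_linear_part_bounds:
  fixes K \<theta> :: real and z :: complex
  assumes "K \<ge> 1"
  defines "L \<equiv> complex_of_real ((K + 1) / 2) * z
                + exp (2 * \<i> * complex_of_real \<theta>) * complex_of_real ((K - 1) / 2) * cnj z"
  shows "cmod z \<le> cmod L" and "cmod L \<le> K * cmod z"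
proof -
  define a where "a = complex_of_real ((K + 1) / 2) * z"
  define b where "b = exp (2 * \<i> * complex_of_real \<theta>) * complex_of_real ((K - 1) / 2) * cnj z"
  have "cmod a = (K + 1) / 2 * cmod z"
    using assms by (simp only: a_def norm_mult norm_of_real) simp
  moreover have "cmod b = (K - 1) / 2 * cmod z"
    using assms by (simp only: b_def norm_mult norm_of_real norm_exp_eq_Re complex_mod_cnj) simp
  moreover have "cmod a - cmod b \<le> cmod (a + b)" "cmod (a + b) \<le> cmod a + cmod b"
    by (rule norm_diff_ineq, rule norm_triangle_ineq)
  ultimately show "cmod z \<le> cmod L" "cmod L \<le> K * cmod z"
    unfolding L_def a_def[symmetric] b_def[symmetric] by (simp_all add: field_simps)
qed

lemma H_map_norm_bounds:
  assumes "K \<ge> 1"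
  shows "(cmod z)\<^sup>2 \<le> cmod (H_map K \<theta> c z) + cmod c"
    and "cmod (H_map K \<theta> c z) \<le> K\<^sup>2 * (cmod z)\<^sup>2 + cmod c"
proof -
  define L where "L = complex_of_real ((K + 1) / 2) * z
                + exp (2 * \<i> * complex_of_real \<theta>) * complex_of_real ((K - 1) / 2) * cnj z"
  have H: "H_map K \<theta> c z = L\<^sup>2 + c"
    by (simp add: H_map_def L_def)
  have "(cmod z)\<^sup>2 \<le> (cmod L)\<^sup>2" "(cmod L)\<^sup>2 \<le> K\<^sup>2 * (cmod z)\<^sup>2"
    using H_map_linear_part_bounds[OF assms, of z \<theta>, folded L_def]
    by (auto simp flip: power_mult_distrib intro!: power_mono)
  moreover have "(cmod L)\<^sup>2 - cmod c \<le> cmod (L\<^sup>2 + c)" "cmod (L\<^sup>2 + c) \<le> (cmod L)\<^sup>2 + cmod c"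
    using norm_diff_ineq[of "L\<^sup>2" c] norm_triangle_ineq[of "L\<^sup>2" c] by (simp_all add: norm_power)
  ultimately show "(cmod z)\<^sup>2 \<le> cmod (H_map K \<theta> c z) + cmod c"
    and "cmod (H_map K \<theta> c z) \<le> K\<^sup>2 * (cmod z)\<^sup>2 + cmod c"
    unfolding H by linarith+
qed

text \<open>The quantities \<open>1 + cmod (H_map K \<theta> c z)\<close> and
  \<open>(1 + cmod z)\<^sup>2\<close> agree up to constant factors, which logarithms turn into a
  bounded additive error. The added \<open>1\<close> keeps the logarithm finite and nonnegative near
  \<open>0\<close>.\<close>

lemma H_map_ln_norm_doubling:
  assumes "K \<ge> 1"
  obtains C where
    "\<And>z. \<bar>ln (1 + cmod (H_map K \<theta> c z)) - 2 * ln (1 + cmod z)\<bar> \<le> C"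
proof -
  define A where "A = K\<^sup>2 + 1 + cmod c"
  define B where "B = 2 + 2 * cmod c"
  have pos: "A \<ge> 1" "B \<ge> 1"
    by (simp_all add: A_def B_def)
  have "\<bar>ln (1 + cmod (H_map K \<theta> c z)) - 2 * ln (1 + cmod z)\<bar> \<le> ln A + ln B" for z
  proof -
    define r where "r = cmod z"
    define s where "s = cmod (H_map K \<theta> c z)"
    have nonneg: "r \<ge> 0" "s \<ge> 0"
      by (simp_all add: r_def s_def)
    have bounds: "r\<^sup>2 \<le> s + cmod c" "s \<le> K\<^sup>2 * r\<^sup>2 + cmod c"
      using H_map_norm_bounds[OF assms] by (simp_all add: r_def s_def)
    have "1 + s \<le> K\<^sup>2 * r\<^sup>2 + (1 + cmod c) * 1"
      using bounds by simp
    \<comment> \<open>Both \<open>r\<^sup>2\<close> and \<open>1\<close> are at most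
      \<open>(1 + r)\<^sup>2\<close>, so the constant terms are absorbed into the factor
      \<open>A\<close>.\<close>
    also have "\<dots> \<le> K\<^sup>2 * (1 + r)\<^sup>2 + (1 + cmod c) * (1 + r)\<^sup>2"
      using nonneg by (intro add_mono mult_left_mono power_mono) (auto simp: one_le_power)
    also have "\<dots> = A * (1 + r)\<^sup>2"
      by (simp add: A_def algebra_simps)
    finally have upper: "1 + s \<le> A * (1 + r)\<^sup>2" .
    have "(1 + r)\<^sup>2 \<le> 2 + 2 * r\<^sup>2"
      using zero_le_power2[of "r - 1"] by (simp add: power2_eq_square algebra_simps)
    also have "\<dots> \<le> 2 + 2 * (s + cmod c)"
      using bounds by simp
    also have "\<dots> \<le> B * (1 + s)"
      using nonneg by (simp add: B_def algebra_simps)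
    finally have lower: "(1 + r)\<^sup>2 \<le> B * (1 + s)" .
    have "ln (1 + s) \<le> ln (A * (1 + r)\<^sup>2)" "ln ((1 + r)\<^sup>2) \<le> ln (B * (1 + s))"
      using upper lower nonneg pos by (intro ln_mono; simp)+
    then have "ln (1 + s) \<le> ln A + 2 * ln (1 + r)" "2 * ln (1 + r) \<le> ln B + ln (1 + s)"
      using nonneg pos by (simp_all add: ln_mult_pos ln_realpow)
    \<comment> \<open>The upper error is \<open>ln A\<close> and the lower one \<open>ln B\<close>;
      nonnegativity lets their sum bound both.\<close>
    moreover have "ln A \<ge> 0" "ln B \<ge> 0"
      using pos by simp_all
    ultimately show ?thesis
      unfolding r_def[symmetric] s_def[symmetric] by linarith
  qed
  then show thesis
    by (rule that)
qed

lemma continuous_on_H_map: "continuous_on S (H_map K \<theta> c)"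
  unfolding H_map_def[abs_def] by (intro continuous_intros)

lemma continuous_on_funpow:
  fixes f :: "'a::topological_space \<Rightarrow> 'a"
  assumes "continuous_on UNIV f"
  shows "continuous_on UNIV (f ^^ n)"
  by (induction n) (auto simp: o_def intro: continuous_on_compose2[OF assms] continuous_on_id)

theorem theorem1p1:
  fixes K \<theta> :: real and c :: complex
  assumes "K > 1" and "\<theta> \<in> {-(pi/2)<..pi/2}"
  shows "\<exists>G :: complex \<Rightarrow> real.
           continuous_on UNIV G
         \<and> (\<forall>z. 0 \<le> G z)
         \<and> (\<forall>z \<in> bounded_orbit_set (H_map K \<theta> c). G z = 0)
         \<and> (\<forall>z \<in> escaping_set (H_map K \<theta> c). G z \<noteq> 0)
         \<and> (\<forall>z. G (H_map K \<theta> c z) = 2 * G z)"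
proof -
  define H where "H = H_map K \<theta> c"
  define u where "u z = ln (1 + cmod z)" for z
  obtain C where "\<And>z. \<bar>u (H z) - 2 * u z\<bar> \<le> C"
    using H_map_ln_norm_doubling[of K \<theta> c] assms(1) unfolding u_def H_def by auto
  then obtain G where unif: "uniform_limit UNIV (\<lambda>n z. u ((H ^^ n) z) / 2 ^ n) G sequentially"
    and G_u: "\<And>z. \<bar>G z - u z\<bar> \<le> C"
    using uniform_limit_doubling_average[of u H C] by blast
  have lim: "(\<lambda>n. u ((H ^^ n) z) / 2 ^ n) \<longlonglongrightarrow> G z" for z
    using tendsto_uniform_limitI[OF unif] by simp
  have u_nonneg: "u z \<ge> 0" for z
    by (simp add: u_def)
  have "continuous_on UNIV u"
    unfolding u_def by (intro continuous_intros) (auto simp: add_nonneg_eq_0_iff)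
  then have "continuous_on UNIV (\<lambda>z. u ((H ^^ n) z) / 2 ^ n)" for n
    using continuous_on_funpow[OF continuous_on_H_map[of UNIV K \<theta> c], of n]
    unfolding H_def by (intro continuous_on_divide continuous_on_const)
      (auto intro: continuous_on_compose2)
  then have G_cont: "continuous_on UNIV G"
    by (intro uniform_limit_theorem[OF _ unif]) auto
  have G_nonneg: "0 \<le> G z" for z
    by (rule LIMSEQ_le_const[OF lim]) (auto simp: u_nonneg)
  have G_H: "G (H z) = 2 * G z" for z
  \<comment> \<open>The sequence at \<open>H z\<close> is twice the sequence at \<open>z\<close>
    shifted by one index.\<close>
  proof (rule LIMSEQ_unique[OF lim])
    have "(\<lambda>n. 2 * (u ((H ^^ Suc n) z) / 2 ^ Suc n)) \<longlonglongrightarrow> 2 * G z"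
      by (intro tendsto_intros LIMSEQ_Suc lim)
    then show "(\<lambda>n. u ((H ^^ n) (H z)) / 2 ^ n) \<longlonglongrightarrow> 2 * G z"
      by (simp add: funpow_swap1)
  qed
  have G_iter: "G ((H ^^ n) z) = 2 ^ n * G z" for n z
    by (induction n) (simp_all add: G_H)
  have "G z = 0" if "z \<in> bounded_orbit_set H" for z
  proof -
    from that obtain M where "M > 0" and M: "\<And>n. cmod ((H ^^ n) z) \<le> M"
      by (auto simp: bounded_orbit_set_def)
    \<comment> \<open>On a bounded orbit the numerators \<open>u ((H ^^ n) z)\<close> stay below
      \<open>ln (1 + M)\<close>, so this null sequence dominates.\<close>
    have "(\<lambda>n. ln (1 + M) / 2 ^ n) \<longlonglongrightarrow> 0"
      by (intro LIMSEQ_divide_realpow_zero) simp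
    moreover have "u ((H ^^ n) z) \<le> ln (1 + M)" for n
      using M[of n] \<open>M > 0\<close> by (simp add: u_def add_pos_nonneg)
    ultimately have "G z \<le> 0"
      by (intro LIMSEQ_le[OF lim]) (auto intro!: divide_right_mono)
    with G_nonneg[of z] show ?thesis
      by simp
  qed
  moreover have "G z \<noteq> 0" if "z \<in> escaping_set H" for z
  proof
    assume "G z = 0"
    have "filterlim (\<lambda>n. cmod ((H ^^ n) z)) at_top sequentially"
      using that filterlim_compose[OF filterlim_norm_at_top] by (auto simp: escaping_set_def)
    \<comment> \<open>The threshold \<open>exp C\<close> makes \<open>u\<close> strictly larger than
      \<open>C\<close>, thanks to the added \<open>1\<close> in \<open>u\<close>.\<close>
    then obtain n where n: "cmod ((H ^^ n) z) \<ge> exp C"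
      unfolding filterlim_at_top eventually_sequentially by blast
    have "C = ln (exp C)"
      by simp
    also have "\<dots> < u ((H ^^ n) z)"
      unfolding u_def using n by (intro ln_less_cancel_iff[THEN iffD2]) (auto intro: add_pos_nonneg)
    \<comment> \<open>If \<open>G\<close> vanishes at \<open>z\<close>, it vanishes along the whole
      orbit, so there \<open>u\<close> lies within \<open>C\<close> of \<open>0\<close>.\<close>
    also have "\<dots> \<le> C"
      using G_u[of "(H ^^ n) z"] by (simp add: G_iter \<open>G z = 0\<close>)
    finally show False
      by simp
  qed
  ultimately show ?thesis
    using G_cont G_nonneg G_H unfolding H_def by blast
qed

end
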